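(* (i) Every $x\in\mathrm{NDE}$ is prevalent in $S_\infty$, i.e. for every $t\in T$ there is $t'\ge_T t$ with $x\in M(t')$. (ii) For every $A\in\mathrm{ClForm}$, if $\models^A_{S_\infty}A$ then $\models^P_{S_\infty}A$.
   Context: $\mathrm{NDE}$ is the set of closed terms generated from $\overline 0$ by a unary symbol $S$ and binary symbols $+$, $\cdot$; for $z\in\mathrm{NDE}$, $[\![z]\!]\in\mathbb N$ is the number it denotes under the standard interpretation. $\mathrm{Eq}=\{x=y: x,y\in\mathrm{NDE}\}$ is the set of formal equations. $\mathrm{ClForm}$ is generated from $\bot$ and $\mathrm{Eq}$ by $\land,\lor,\to$; $\neg A$ abbreviates $A\to\bot$. $S_\infty=\langle T,\le_T,M,E\rangle$ is the following rooted, finitely branching tree, all of whose branches are $\omega$-sequences, with $M:T\to\mathcal P(\mathrm{NDE})$ and $E:T\to\mathcal P(\mathrm{Eq})$. The root $t_0$ has $M(t_0)=\{\overline 0\}$, $E(t_0)=\emptyset$. The direct successors of a node $t$ are the following, for all $x,y\in M(t)$: (1) for $z$ each of $S(x)$, $x+y$, $x\cdot y$ with $z\notin M(t)$, a direct successor $t'$ with $M(t')=M(t)\cup\{z\}$, $E(t')=E(t)$; (2) if $[\![x]\!]=[\![y]\!]$ and $(x=y)\notin E(t)$, a direct successor $t'$ with $M(t')=M(t)$, $E(t')=E(t)\cup\{x=y\}$. Forcing: $t\models p$ iff $p\in E(t)$ for $p\in\mathrm{Eq}$; $t\not\models\bot$; $t\models A\land B$ iff $t\models A$ and $t\models B$;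 $t\models A\lor B$ iff $t\models A$ or $t\models B$; $t\models A\to B$ iff for every $t'\ge_T t$ with $t'\models A$ there is $t''\ge_T t'$ with $t''\models B$. $\models^A_{S_\infty}A$ (assertible): $t\models A$ for some $t\in T$. $\models^P_{S_\infty}A$ (prevalent): for every $t\in T$ there is $t'\ge_T t$ with $t'\models A$. *)

theory Defs
  imports Main
begin

datatype nde = Zero | Succ nde | Plus nde nde | Times nde nde

fun denote :: "nde \<Rightarrow> nat" where
  "denote Zero = 0"
| "denote (Succ x) = Suc (denote x)"
| "denote (Plus x y) = denote x + denote y"
| "denote (Times x y) = denote x * denote y"

datatype equation = Equation nde nde  (infix \<open>\<doteq>\<close> 60)

datatype clform =
    Bot
  | Eqn equation
  | Conj clform clform
  | Disj clform clform
  | Imp clform clform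

record 'n strct =
  nodes :: "'n set"
  le :: "'n \<Rightarrow> 'n \<Rightarrow> bool"
  terms_at :: "'n \<Rightarrow> nde set"
  eqs_at :: "'n \<Rightarrow> equation set"

fun forces :: "('n, 'm) strct_scheme \<Rightarrow> 'n \<Rightarrow> clform \<Rightarrow> bool" where
  "forces S t Bot \<longleftrightarrow> False"
| "forces S t (Eqn p) \<longleftrightarrow> p \<in> eqs_at S t"
| "forces S t (Conj A B) \<longleftrightarrow> forces S t A \<and> forces S t B"
| "forces S t (Disj A B) \<longleftrightarrow> forces S t A \<or> forces S t B"
| "forces S t (Imp A B) \<longleftrightarrow>
     (\<forall>t'\<in>nodes S. le S t t' \<and> forces S t' A \<longrightarrow>
        (\<exists>t''\<in>nodes S. le S t' t'' \<and> forces S t'' B))"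

definition assertible :: "('n, 'm) strct_scheme \<Rightarrow> clform \<Rightarrow> bool" where
  "assertible S A \<longleftrightarrow> (\<exists>t\<in>nodes S. forces S t A)"

definition prevalent :: "('n, 'm) strct_scheme \<Rightarrow> clform \<Rightarrow> bool" where
  "prevalent S A \<longleftrightarrow> (\<forall>t\<in>nodes S. \<exists>t'\<in>nodes S. le S t t' \<and> forces S t' A)"

definition prevalent_term :: "('n, 'm) strct_scheme \<Rightarrow> nde \<Rightarrow> bool" where
  "prevalent_term S x \<longleftrightarrow> (\<forall>t\<in>nodes S. \<exists>t'\<in>nodes S. le S t t' \<and> x \<in> terms_at S t')"

text \<open>
  Since \<open>S\<^sub>\<infinity>\<close> is a tree, nodes reached from the root along different paths are
  different even if they carry the same terms and equations. A node is therefore the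
  list of the additions leading to it from the root, the latest one first.
\<close>

datatype addition = New_term nde | New_eq equation

type_synonym node = "addition list"

fun M_inf :: "node \<Rightarrow> nde set" where
  "M_inf [] = {Zero}"
| "M_inf (New_term z # t) = M_inf t \<union> {z}"
| "M_inf (New_eq p # t) = M_inf t"

fun E_inf :: "node \<Rightarrow> equation set" where
  "E_inf [] = {}"
| "E_inf (New_term z # t) = E_inf t"
| "E_inf (New_eq p # t) = E_inf t \<union> {p}"

inductive direct_succ :: "node \<Rightarrow> node \<Rightarrow> bool" where
  add_Succ: "x \<in> M_inf t \<Longrightarrow> Succ x \<notin> M_inf t \<Longrightarrow>
    direct_succ t (New_term (Succ x) # t)"
| add_Plus: "x \<in> M_inf t \<Longrightarrow> y \<in> M_inf t \<Longrightarrow> Plus x y \<notin> M_inf t \<Longrightarrow>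
    direct_succ t (New_term (Plus x y) # t)"
| add_Times: "x \<in> M_inf t \<Longrightarrow> y \<in> M_inf t \<Longrightarrow> Times x y \<notin> M_inf t \<Longrightarrow>
    direct_succ t (New_term (Times x y) # t)"
| add_eq: "x \<in> M_inf t \<Longrightarrow> y \<in> M_inf t \<Longrightarrow> denote x = denote y \<Longrightarrow>
    (x \<doteq> y) \<notin> E_inf t \<Longrightarrow> direct_succ t (New_eq (x \<doteq> y) # t)"

definition S_inf :: "node strct" where
  "S_inf = \<lparr>nodes = {t. direct_succ\<^sup>*\<^sup>* [] t}, le = direct_succ\<^sup>*\<^sup>*,
            terms_at = M_inf, eqs_at = E_inf\<rparr>"

text \<open>
  The remaining facts confirm that \<open>S_inf\<close> is a finitely branching tree without leaves.
\<close>

lemma direct_succ_unique_pred: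
  "direct_succ s t \<Longrightarrow> direct_succ s' t \<Longrightarrow> s = s'"
  by (auto elim!: direct_succ.cases)

lemma direct_succ_length: "direct_succ s t \<Longrightarrow> length t = Suc (length s)"
  by (auto elim: direct_succ.cases)

lemma finite_M_inf: "finite (M_inf t)"
  by (induction t rule: M_inf.induct) auto

lemma finitely_branching: "finite {t'. direct_succ t t'}"
proof (rule finite_subset)
  let ?P = "M_inf t \<times> M_inf t"
  show "{t'. direct_succ t t'} \<subseteq>
      (\<lambda>x. New_term (Succ x) # t) ` M_inf t \<union>
      (\<lambda>(x, y). New_term (Plus x y) # t) ` ?P \<union>
      (\<lambda>(x, y). New_term (Times x y) # t) ` ?P \<union>
      (\<lambda>(x, y). New_eq (x \<doteq> y) # t) ` ?P"
    by (auto elim!: direct_succ.cases)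
qed (simp add: finite_M_inf)

lemma no_leaves: "\<exists>t'. direct_succ t t'"
proof -
  have "Zero \<in> M_inf t"
    by (induction t rule: M_inf.induct) auto
  then have "Max (size ` M_inf t) \<in> size ` M_inf t"
    by (intro Max_in) (auto simp: finite_M_inf)
  then obtain x where x: "x \<in> M_inf t" "size x = Max (size ` M_inf t)"
    by auto
  have "size y \<le> size x" if "y \<in> M_inf t" for y
    unfolding x(2) using that by (simp add: finite_M_inf)
  then have "Succ x \<notin> M_inf t"
    by fastforce
  then show ?thesis
    using x(1) add_Succ by blast
qed

end

theory Submission
  imports Defs
begin

text \<open>
  What a node forces depends only on its terms and equations, since two nodes with the same
  terms and equations have the same possible continuations. Any two nodes \<open>s\<close> and \<open>t\<close> have
  extensions with the same terms and equations: above \<open>t\<close> repeat the additions that led to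
  \<open>s\<close>, omitting those already made, and vice versa. As forcing is monotone, a formula forced
  at \<open>s\<close> is then forced above \<open>t\<close>.
\<close>

lemma Zero_in_M_inf: "Zero \<in> M_inf t"
  by (induction t rule: M_inf.induct) auto

lemma direct_succ_mono:
  assumes "direct_succ s t"
  shows "M_inf s \<subseteq> M_inf t" and "E_inf s \<subseteq> E_inf t"
  using assms by (auto elim: direct_succ.cases)

lemma reachable_mono:
  assumes "direct_succ\<^sup>*\<^sup>* s t"
  shows "M_inf s \<subseteq> M_inf t" and "E_inf s \<subseteq> E_inf t"
  using assms by (induction rule: rtranclp_induct) (use direct_succ_mono in blast)+

text \<open>By induction on the term: extend until the immediate subterms are present. They persist,
  so the compound term is either there already or may be added next.\<close>

lemma reachable_term: "\<exists>t'. direct_succ\<^sup>*\<^sup>* t t' \<and> x \<in> M_inf t'"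
proof -
  \<comment> \<open>Both arguments are assumed reachable from every node, because \<open>y\<close>
    is sought above a node \<open>u\<close> that already contains \<open>x\<close>.\<close>
  have binary: "\<exists>t'. direct_succ\<^sup>*\<^sup>* t t' \<and> f x y \<in> M_inf t'"
    if x: "\<And>t. \<exists>t'. direct_succ\<^sup>*\<^sup>* t t' \<and> x \<in> M_inf t'"
      and y: "\<And>t. \<exists>t'. direct_succ\<^sup>*\<^sup>* t t' \<and> y \<in> M_inf t'"
      and f: "\<And>t. x \<in> M_inf t \<Longrightarrow> y \<in> M_inf t \<Longrightarrow> f x y \<notin> M_inf t \<Longrightarrow>
        direct_succ t (New_term (f x y) # t)"
    for x y f t
  proof -
    obtain u where u: "direct_succ\<^sup>*\<^sup>* t u" "x \<in> M_inf u"
      using x by blast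
    obtain v where v: "direct_succ\<^sup>*\<^sup>* u v" "y \<in> M_inf v"
      using y by blast
    have tv: "direct_succ\<^sup>*\<^sup>* t v"
      using u(1) v(1) by (rule rtranclp_trans)
    have "x \<in> M_inf v"
      using u(2) reachable_mono(1)[OF v(1)] by blast
    then have "f x y \<in> M_inf v \<or> direct_succ v (New_term (f x y) # v)"
      using f v(2) by blast
    then show ?thesis
      using tv by (auto intro: rtranclp.rtrancl_into_rtrancl)
  qed
  show ?thesis
  proof (induction x arbitrary: t)
    case Zero
    then show ?case
      using Zero_in_M_inf by blast
  next
    case (Succ x)
    show ?case
      \<comment> \<open>The unary constructor is treated as a binary one that ignores its second
        argument.\<close>
      using binary[of x x "\<lambda>x _. Succ x", OF Succ.IH Succ.IH add_Succ] by blast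
  next
    case (Plus x y)
    show ?case
      using binary[OF Plus.IH add_Plus] .
  next
    case (Times x y)
    show ?case
      using binary[OF Times.IH add_Times] .
  qed
qed

definition same_content :: "node \<Rightarrow> node \<Rightarrow> bool" where
  "same_content s t \<longleftrightarrow> M_inf s = M_inf t \<and> E_inf s = E_inf t"

lemma same_content_sym: "same_content s t \<Longrightarrow> same_content t s"
  by (simp add: same_content_def)

text \<open>The side conditions of \<open>direct_succ\<close> inspect only the terms and equations
  of a node, so the same addition is allowed at \<open>t\<close>. Thus \<open>same_content\<close>
  is a bisimulation.\<close>

lemma direct_succ_same_content:
  assumes "direct_succ s s'" "same_content s t"
  shows "\<exists>t'. direct_succ t t' \<and> same_content s' t'"
proof -
  obtain a where a: "s' = a # s"
    using assms(1) by (auto elim: direct_succ.cases)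
  have content: "M_inf s = M_inf t" "E_inf s = E_inf t"
    using assms(2) by (simp_all add: same_content_def)
  have "direct_succ t (a # t)"
    using assms(1) unfolding a
    by (cases rule: direct_succ.cases) (simp_all add: content direct_succ.intros)
  moreover have "same_content s' (a # t)"
    unfolding a same_content_def by (cases a) (simp_all add: content)
  ultimately show ?thesis
    by blast
qed

lemma reachable_same_content:
  assumes "direct_succ\<^sup>*\<^sup>* s s'" "same_content s t"
  shows "\<exists>t'. direct_succ\<^sup>*\<^sup>* t t' \<and> same_content s' t'"
  using assms
proof (induction rule: rtranclp_induct)
  case (step u v)
  then obtain u' where "direct_succ\<^sup>*\<^sup>* t u'" "same_content u u'"
    by blast
  moreover obtain v' where "direct_succ u' v'" "same_content v v'"
    using direct_succ_same_content[OF step.hyps(2)] calculation(2) by blast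
  ultimately show ?case
    using rtranclp.rtrancl_into_rtrancl by metis
qed blast

lemma reachable_nodes: "s \<in> nodes S_inf \<Longrightarrow> direct_succ\<^sup>*\<^sup>* s t \<Longrightarrow> t \<in> nodes S_inf"
  by (auto simp: S_inf_def)

lemma le_S_inf: "le S_inf = direct_succ\<^sup>*\<^sup>*"
  by (simp add: S_inf_def)

text \<open>Extensions of a node are nodes, so the quantifiers may range over plain reachability,
  which is what the bisimulation transports.\<close>

lemma forces_Imp_S_inf:
  assumes "t \<in> nodes S_inf"
  shows "forces S_inf t (Imp A B) \<longleftrightarrow>
    (\<forall>t'. direct_succ\<^sup>*\<^sup>* t t' \<and> forces S_inf t' A \<longrightarrow>
      (\<exists>t''. direct_succ\<^sup>*\<^sup>* t' t'' \<and> forces S_inf t'' B))"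
  unfolding forces.simps le_S_inf using reachable_nodes assms by meson

text \<open>Equations persist, and an implication speaks only about extensions: those of
  \<open>t\<close> are also extensions of \<open>s\<close>.\<close>

lemma forces_mono:
  assumes "direct_succ\<^sup>*\<^sup>* s t" "forces S_inf s A"
  shows "forces S_inf t A"
  using assms
proof (induction A)
  case (Eqn p)
  then show ?case
    using reachable_mono(2) by (auto simp: S_inf_def)
next
  case (Imp A B)
  then show ?case
    unfolding forces.simps le_S_inf using rtranclp_trans by metis
qed (simp; blast)+

lemma forces_same_content:
  assumes "s \<in> nodes S_inf" "t \<in> nodes S_inf" "same_content s t" "forces S_inf s A"
  shows "forces S_inf t A"
  using assms
proof (induction A arbitrary: s t)
  case (Eqn p)
  then show ?case
    by (simp add: S_inf_def same_content_def)
next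
  case (Imp A B)
  show ?case
    unfolding forces_Imp_S_inf[OF Imp.prems(2)]
  proof (intro allI impI, elim conjE)
    fix t' assume t': "direct_succ\<^sup>*\<^sup>* t t'" "forces S_inf t' A"
    \<comment> \<open>Back and forth: \<open>t'\<close> is mirrored above \<open>s\<close>, where
      the implication is known, and the resulting witness \<open>s''\<close> is mirrored above
      \<open>t'\<close>. The hypothesis for \<open>A\<close> is thus used from the side of
      \<open>t\<close> to that of \<open>s\<close>, the one for \<open>B\<close> in the other
      direction.\<close>
    obtain s' where s': "direct_succ\<^sup>*\<^sup>* s s'" "same_content t' s'"
      using reachable_same_content[OF t'(1)] Imp.prems(3) same_content_sym by blast
    have nodes': "s' \<in> nodes S_inf" "t' \<in> nodes S_inf"
      using reachable_nodes Imp.prems s'(1) t'(1) by blast+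
    then have "forces S_inf s' A"
      using Imp.IH(1) s'(2) t'(2) by blast
    then obtain s'' where s'': "direct_succ\<^sup>*\<^sup>* s' s''" "forces S_inf s'' B"
      using Imp.prems(4) s'(1) unfolding forces_Imp_S_inf[OF Imp.prems(1)] by blast
    obtain t'' where t'': "direct_succ\<^sup>*\<^sup>* t' t''" "same_content s'' t''"
      using reachable_same_content[OF s''(1)] s'(2) same_content_sym by blast
    have "forces S_inf t'' B"
      using Imp.IH(2) reachable_nodes nodes' s'' t'' by blast
    then show "\<exists>t''. direct_succ\<^sup>*\<^sup>* t' t'' \<and> forces S_inf t'' B"
      using t''(1) by blast
  qed
qed (simp; blast)+

text \<open>The history of \<open>s\<close> is replayed above \<open>t\<close>, by induction along
  the path from the root; at the root, \<open>Zero\<close> is already a term of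
  \<open>t\<close>.\<close>

lemma reachable_union:
  assumes "direct_succ\<^sup>*\<^sup>* [] s"
  shows "\<exists>t'. direct_succ\<^sup>*\<^sup>* t t' \<and> M_inf t' = M_inf t \<union> M_inf s \<and> E_inf t' = E_inf t \<union> E_inf s"
  using assms
proof (induction rule: rtranclp_induct)
  case base
  then show ?case
    using Zero_in_M_inf by auto
next
  case (step s s')
  then obtain u where u: "direct_succ\<^sup>*\<^sup>* t u"
    "M_inf u = M_inf t \<union> M_inf s" "E_inf u = E_inf t \<union> E_inf s"
    by blast
  obtain a where a: "s' = a # s"
    using step.hyps(2) by (auto elim: direct_succ.cases)
  \<comment> \<open>The terms that \<open>a\<close> is built from lie in \<open>M_inf s\<close>,
    hence in \<open>M_inf u\<close>, so only lack of novelty can block \<open>a\<close>. In that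
    case \<open>a # u\<close> serves merely to compute the content, and \<open>u\<close> itself is
    the extension sought.\<close>
  have "direct_succ u (a # u) \<or> M_inf (a # u) = M_inf u \<and> E_inf (a # u) = E_inf u"
    using step.hyps(2) unfolding a
    by (cases rule: direct_succ.cases) (auto simp: u(2,3) insert_absorb intro!: direct_succ.intros)
  moreover have "M_inf (a # u) = M_inf t \<union> M_inf s'" "E_inf (a # u) = E_inf t \<union> E_inf s'"
    using u(2,3) unfolding a by (cases a; auto)+
  ultimately show ?case
    using u(1) by (metis rtranclp.rtrancl_into_rtrancl)
qed

theorem proposition4:
  shows "(\<forall>x :: nde. prevalent_term S_inf x) \<and>
    (\<forall>A :: clform. assertible S_inf A \<longrightarrow> prevalent S_inf A)"
proof (intro conjI allI impI)
  fix x
  show "prevalent_term S_inf x"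
    unfolding prevalent_term_def
  proof
    fix t assume "t \<in> nodes S_inf"
    then show "\<exists>t'\<in>nodes S_inf. le S_inf t t' \<and> x \<in> terms_at S_inf t'"
      using reachable_term[of t x] by (auto simp: S_inf_def intro: rtranclp_trans)
  qed
next
  fix A assume "assertible S_inf A"
  then obtain s where s: "direct_succ\<^sup>*\<^sup>* [] s" "forces S_inf s A"
    by (auto simp: assertible_def S_inf_def)
  show "prevalent S_inf A"
    unfolding prevalent_def
  proof
    fix t assume "t \<in> nodes S_inf"
    then have t: "direct_succ\<^sup>*\<^sup>* [] t"
      by (simp add: S_inf_def)
    obtain t' where t': "direct_succ\<^sup>*\<^sup>* t t'"
      "M_inf t' = M_inf t \<union> M_inf s" "E_inf t' = E_inf t \<union> E_inf s"
      using reachable_union[OF s(1)] by blast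
    obtain s' where s': "direct_succ\<^sup>*\<^sup>* s s'"
      "M_inf s' = M_inf s \<union> M_inf t" "E_inf s' = E_inf s \<union> E_inf t"
      using reachable_union[OF t] by blast
    have "s' \<in> nodes S_inf" and t'_node: "t' \<in> nodes S_inf"
      using s(1) s'(1) t t'(1) by (auto simp: S_inf_def)
    \<comment> \<open>Both contents are the union of those of \<open>s\<close> and \<open>t\<close>,
      taken in opposite orders.\<close>
    moreover have "same_content s' t'"
      using s' t' by (auto simp: same_content_def)
    moreover have "forces S_inf s' A"
      using forces_mono s'(1) s(2) by blast
    ultimately have "forces S_inf t' A"
      using forces_same_content by blast
    then show "\<exists>t'\<in>nodes S_inf. le S_inf t t' \<and> forces S_inf t' A"
      using t'(1) t'_node by (auto simp: S_inf_def)
  qed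
qed

end
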